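(* Let $k,l\ge2$ be integers and let $t=a^kb^l$ ($k$ copies of $a$ followed by $l$ copies of $b$, with $a\ne b$). Then every finite simple graph is $t$-representable.
   Context: Two words are isomorphic if one is obtained from the other by a bijective renaming of letters. For a word $w$ and letters $x,y$, $w|_{xy}$ denotes the subword of $w$ consisting of all occurrences of $x$ and $y$ (in order). A word $u$ over the two letters $\{a,b\}$ occurs in $w|_{xy}$ ($x\neq y$) if some contiguous factor of $w|_{xy}$ is isomorphic to $u$; otherwise $w|_{xy}$ avoids $u$. For a word $t$ on two letters, a graph $G=(V,E)$ is $t$-representable if there is a word $w$ over the alphabet $V$ containing each letter of $V$ at least once such that for all distinct $x,y\in V$, $xy\in E$ if and only if $w|_{xy}$ avoids $t$. *)

theory Defs
  imports Main "HOL-Library.Sublist"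
begin

definition isomorphic_words :: "'a list \<Rightarrow> 'b list \<Rightarrow> bool" where
  "isomorphic_words u v \<longleftrightarrow> (\<exists>f. bij_betw f (set u) (set v) \<and> v = map f u)"

definition restrict_word :: "'a list \<Rightarrow> 'a \<Rightarrow> 'a \<Rightarrow> 'a list" where
  "restrict_word w x y = filter (\<lambda>z. z = x \<or> z = y) w"

text \<open>Contiguous factors are given by \<^const>\<open>sublist\<close>, not by \<^const>\<open>subseq\<close>.
  The letters of the pattern need not come from the alphabet of the word.\<close>

definition word_occurs :: "'b list \<Rightarrow> 'a list \<Rightarrow> bool" where
  "word_occurs u v \<longleftrightarrow> (\<exists>f. sublist f v \<and> isomorphic_words u f)"

abbreviation word_avoids :: "'a list \<Rightarrow> 'b list \<Rightarrow> bool" where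
  "word_avoids v u \<equiv> \<not> word_occurs u v"

locale finite_simple_graph =
  fixes V :: "'a set" and E :: "'a set set"
  assumes finite_vertices: "finite V"
    and edges: "\<And>e. e \<in> E \<Longrightarrow> e \<subseteq> V \<and> card e = 2"

definition representable :: "'b list \<Rightarrow> 'a set \<Rightarrow> 'a set set \<Rightarrow> bool" where
  "representable t V E \<longleftrightarrow>
     (\<exists>w. set w = V \<and>
       (\<forall>x\<in>V. \<forall>y\<in>V. x \<noteq> y \<longrightarrow>
          ({x, y} \<in> E \<longleftrightarrow> word_avoids (restrict_word w x y) t)))"

end

theory Submission
  imports Defs
begin

text \<open>
  Fix an enumeration \<open>p\<close> of the vertices and start from \<open>p p\<close>. For every non-edge \<open>xy\<close> append
  \<open>(x r)\<^sup>k (y r)\<^sup>l p p\<close>, where \<open>r\<close> is \<open>p\<close> with \<open>x\<close> and \<open>y\<close> deleted. Restricted to \<open>x, y\<close> the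
  appended word contains \<open>x\<^sup>k y\<^sup>l\<close>. Restricted to any other pair it is an alternating word, except
  for one long run \<open>z\<^sup>k\<close> or \<open>z\<^sup>l\<close> and some runs of length two at the seams; the alternating parts
  keep these apart, so that no two adjacent runs both have length at least two.
\<close>

text \<open>Avoidance of a a b b up to renaming. It does not mention k and l, and for k, l \<ge> 2
  it implies avoidance of a^k b^l.\<close>

definition double_free :: "'a list \<Rightarrow> bool" where
  "double_free w \<longleftrightarrow> (\<forall>p q. p \<noteq> q \<longrightarrow> \<not> sublist [p, p, q, q] w)"

lemma double_free_short: "double_free []" "double_free [p]"
  by (auto simp: double_free_def sublist_Cons_right)

text \<open>This rule and the next two strip letters from the front: in each, no forbidden factor
  can start at a removed position. Together they let the simplifier evaluate
  \<open>double_free\<close> from left to right.\<close>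

lemma double_free_neq: "p \<noteq> q \<Longrightarrow> double_free (p # q # w) \<longleftrightarrow> double_free (q # w)"
  by (auto simp: double_free_def sublist_Cons_right)

lemma double_free_triple: "double_free (p # p # p # w) \<longleftrightarrow> double_free (p # p # w)"
  by (auto simp: double_free_def sublist_Cons_right)

lemma double_free_double:
  "p \<noteq> q \<Longrightarrow> double_free (p # p # q # p # w) \<longleftrightarrow> double_free (p # w)"
  by (auto simp: double_free_def sublist_Cons_right)

lemmas double_free_simps = double_free_neq double_free_triple double_free_double

text \<open>The run of p is followed by a run of q of length exactly one, so its own length is
  irrelevant. Lengths one, two and at least three each fall under one stripping rule.\<close>

lemma double_free_run:
  assumes "p \<noteq> q"
  shows "double_free (p # replicate n p @ q # p # w) \<longleftrightarrow> double_free (p # w)"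
proof (induction n)
  case 0
  then show ?case using assms by (simp add: double_free_simps)
next
  case (Suc n)
  then show ?case using assms by (cases n) (simp_all add: double_free_simps)
qed

text \<open>The shape of a run after \<open>replicate\<close> at a successor has been
  unfolded.\<close>

lemma double_free_run_Suc:
  assumes "p \<noteq> q"
  shows "double_free (p # p # replicate n p @ q # p # w) \<longleftrightarrow> double_free (p # w)"
  using double_free_run[OF assms, of "Suc n"] by simp

lemma double_free_alternating:
  assumes "p \<noteq> q"
  shows "double_free (q # concat (replicate n [p, q]) @ w) \<longleftrightarrow> double_free (q # w)"
  using assms by (induction n) (simp_all add: double_free_simps)

definition gadget :: "nat \<Rightarrow> nat \<Rightarrow> 'a list \<Rightarrow> 'a \<times> 'a \<Rightarrow> 'a list" where
  "gadget k l p = (\<lambda>(x, y). let r = filter (\<lambda>z. z \<noteq> x \<and> z \<noteq> y) p in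
     concat (replicate k (x # r)) @ concat (replicate l (y # r)))"

definition graph_word :: "nat \<Rightarrow> nat \<Rightarrow> 'a list \<Rightarrow> ('a \<times> 'a) list \<Rightarrow> 'a list" where
  "graph_word k l p ps = p @ p @ concat (map (\<lambda>e. gadget k l p e @ p @ p) ps)"

lemma restrict_word_append: "restrict_word (v @ w) x y = restrict_word v x y @ restrict_word w x y"
  by (simp add: restrict_word_def)

lemma restrict_word_commute: "restrict_word w x y = restrict_word w y x"
  by (simp add: restrict_word_def disj_commute)

lemma restrict_word_distinct:
  assumes "distinct p" "u \<in> set p" "v \<in> set p" "u \<noteq> v"
  shows "restrict_word p u v = [u, v] \<or> restrict_word p u v = [v, u]"
proof -
  let ?f = "restrict_word p u v"
  have d: "distinct ?f" and s: "set ?f = {u, v}"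
    using assms by (auto simp: restrict_word_def)
  have "length ?f = 2"
    using distinct_card[OF d] s assms(4) by simp
  then obtain c d where "?f = [c, d]"
    by (auto simp: numeral_2_eq_2 length_Suc_conv)
  with d s show ?thesis by (auto simp: doubleton_eq_iff)
qed

lemma restrict_word_concat_replicate:
  "restrict_word (concat (replicate n w)) x y = concat (replicate n (restrict_word w x y))"
  by (simp add: restrict_word_def filter_concat)

lemma restrict_gadget:
  "restrict_word (gadget k l p (x, y)) u v =
    (let r = filter (\<lambda>z. z \<noteq> x \<and> z \<noteq> y) (restrict_word p u v) in
      concat (replicate k (restrict_word [x] u v @ r)) @
      concat (replicate l (restrict_word [y] u v @ r)))"
proof -
  let ?r = "filter (\<lambda>z. z \<noteq> x \<and> z \<noteq> y) p"
  have r: "restrict_word ?r u v = filter (\<lambda>z. z \<noteq> x \<and> z \<noteq> y) (restrict_word p u v)"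
    by (simp add: restrict_word_def conj_commute)
  have "restrict_word (z # ?r) u v = restrict_word [z] u v @ restrict_word ?r u v" for z
    using restrict_word_append[of "[z]" ?r u v] by simp
  with r show ?thesis
    by (simp only: gadget_def Let_def prod.case restrict_word_append restrict_word_concat_replicate)
qed

lemma concat_replicate_singleton: "concat (replicate n [x]) = replicate n x"
  by (induction n) auto

lemma restrict_gadget_self:
  assumes "x \<noteq> y"
  shows "restrict_word (gadget k l p (x, y)) x y = replicate k x @ replicate l y"
proof -
  have "filter (\<lambda>z. z \<noteq> x \<and> z \<noteq> y) (restrict_word p x y) = []"
    by (auto simp: restrict_word_def filter_empty_conv)
  then show ?thesis
    by (simp add: restrict_gadget Let_def concat_replicate_singleton) 
      (simp add: restrict_word_def concat_replicate_singleton)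
qed

text \<open>Induction step for the whole word: the \<open>[u, v, u, v]\<close> closing one gadget is
  also the one opening the next. The order of u and v in p is fixed here; the other order follows by
  symmetry.\<close>

lemma double_free_gadget:
  assumes kl: "k \<ge> 2" "l \<ge> 2" and uv: "u \<noteq> v" and xy: "x \<noteq> y" "{x, y} \<noteq> {u, v}"
    and p: "restrict_word p u v = [u, v]"
    and w: "double_free ([u, v, u, v] @ w)"
  shows "double_free ([u, v, u, v] @ restrict_word (gadget k l p (x, y)) u v @ [u, v, u, v] @ w)"
proof -
  \<comment> \<open>Exposing two copies of each repeated block makes the seams visible to the
    simplifier.\<close>
  obtain k' l' where k: "k = Suc (Suc k')" and l: "l = Suc (Suc l')"
    using kl by (metis Suc_le_D numeral_2_eq_2 Suc_le_mono)
  have w': "double_free (v # w)"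
    using w uv by (simp add: double_free_simps)
  note simps = double_free_simps double_free_alternating double_free_run double_free_run_Suc
    replicate_app_Cons_same
  have letter: "restrict_word [z] u v = (if z \<in> {u, v} then [z] else [])" for z
    by (simp add: restrict_word_def)
  note g = restrict_gadget Let_def p letter concat_replicate_singleton
  \<comment> \<open>At most one of x, y lies in {u, v}, since otherwise the two pairs would
    coincide.\<close>
  consider "x = u" "y \<notin> {u, v}" | "x = v" "y \<notin> {u, v}" | "y = u" "x \<notin> {u, v}"
    | "y = v" "x \<notin> {u, v}" | "x \<notin> {u, v}" "y \<notin> {u, v}"
    using xy by auto
  then show ?thesis
  proof cases
    case 1
    then have "restrict_word (gadget k l p (x, y)) u v = concat (replicate k [u, v]) @ replicate l v"
      using uv by (auto simp: g)
    then show ?thesis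
      using uv w' by (simp add: simps l)
  next
    \<comment> \<open>The left seam creates v v and the block ends in a long run of u. Since k \<ge>
      2, a single u and a single v stand between them.\<close>
    case 2
    then have "restrict_word (gadget k l p (x, y)) u v = concat (replicate k [v, u]) @ replicate l u"
      using uv by (auto simp: g)
    then show ?thesis
      using uv w' by (simp add: simps k l)
  next
    case 3
    then have "restrict_word (gadget k l p (x, y)) u v = replicate k v @ concat (replicate l [u, v])"
      using uv by (auto simp: g)
    then show ?thesis
      using uv w' by (simp add: simps k l)
  next
    \<comment> \<open>The run of u and the u u at the right seam are separated by the alternating
      block, in which every v is single.\<close>
    case 4
    then have "restrict_word (gadget k l p (x, y)) u v = replicate k u @ concat (replicate l [v, u])"
      using uv by (auto simp: g)
    then show ?thesis
      using uv w' by (simp add: simps k l)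
  next
    case 5
    then have "restrict_word (gadget k l p (x, y)) u v
        = concat (replicate k [u, v]) @ concat (replicate l [u, v])"
      using uv by (auto simp: g)
    then show ?thesis
      using uv w' by (simp add: simps)
  qed
qed

lemma double_free_graph_word:
  assumes kl: "k \<ge> 2" "l \<ge> 2" and uv: "u \<noteq> v"
    and p: "restrict_word p u v = [u, v]"
    and ps: "\<forall>(x, y) \<in> set ps. x \<noteq> y \<and> {x, y} \<noteq> {u, v}"
  shows "double_free (restrict_word (graph_word k l p ps) u v)"
  using ps
proof (induction ps)
  case Nil
  then show ?case
    using uv by (simp add: graph_word_def restrict_word_append p double_free_simps double_free_short)
next
  case (Cons e ps)
  obtain x y where e: "e = (x, y)" by force
  define w where "w = restrict_word (concat (map (\<lambda>e. gadget k l p e @ p @ p) ps)) u v"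
  \<comment> \<open>The leading p p followed by the remaining gadgets is \<open>graph_word\<close>
    for the tail of the list.\<close>
  have "double_free ([u, v, u, v] @ w)"
    using Cons by (simp add: graph_word_def restrict_word_append p w_def)
  then have "double_free ([u, v, u, v] @ restrict_word (gadget k l p (x, y)) u v @ [u, v, u, v] @ w)"
    using Cons.prems by (intro double_free_gadget kl uv p) (auto simp: e)
  then show ?case
    by (simp add: graph_word_def restrict_word_append p w_def e)
qed

lemma double_free_avoids:
  assumes "double_free w" "k \<ge> 2" "l \<ge> 2" "a \<noteq> b"
  shows "word_avoids w (replicate k a @ replicate l b)"
proof
  assume "word_occurs (replicate k a @ replicate l b) w"
  then obtain f where f: "inj_on f (set (replicate k a @ replicate l b))"
    and s: "sublist (map f (replicate k a @ replicate l b)) w"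
    unfolding word_occurs_def isomorphic_words_def bij_betw_def by blast
  have ne: "f a \<noteq> f b"
    using f assms(2-4) by (auto simp: inj_on_def)
  \<comment> \<open>The splittings put the two letters on each side of the border between the runs
    next to each other.\<close>
  obtain k' where k: "k = k' + 2" using assms(2) le_Suc_ex by (metis add.commute)
  obtain l' where l: "l = 2 + l'" using assms(3) le_Suc_ex by blast
  have "map f (replicate k a @ replicate l b)
      = replicate k' (f a) @ [f a, f a, f b, f b] @ replicate l' (f b)"
    unfolding k l replicate_add by (simp add: numeral_2_eq_2)
  then have "sublist [f a, f a, f b, f b] w"
    using s sublist_order.order_trans sublist_appendI by metis
  with assms(1) ne show False
    by (auto simp: double_free_def)
qed

lemma graph_word_occurs:
  assumes "(x, y) \<in> set ps" "x \<noteq> y" "k > 0" "l > 0" "a \<noteq> b"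
  shows "word_occurs (replicate k a @ replicate l b) (restrict_word (graph_word k l p ps) x y)"
proof -
  obtain qs rs where "ps = qs @ (x, y) # rs"
    using assms(1) by (meson split_list)
  then obtain v w where "graph_word k l p ps = v @ gadget k l p (x, y) @ w"
    by (simp add: graph_word_def) (metis append.assoc)
  then have "sublist (replicate k x @ replicate l y) (restrict_word (graph_word k l p ps) x y)"
    using assms(2) by (metis restrict_word_append restrict_gadget_self sublist_appendI)
  \<comment> \<open>The renaming sends a to x and everything else, in particular b, to y.\<close>
  moreover have "isomorphic_words (replicate k a @ replicate l b) (replicate k x @ replicate l y)"
    using assms by (auto simp: isomorphic_words_def bij_betw_def inj_on_def
        intro!: exI[of _ "\<lambda>z. if z = a then x else y"])
  ultimately show ?thesis
    by (auto simp: word_occurs_def)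
qed

lemma set_graph_word:
  assumes "set ps \<subseteq> set p \<times> set p"
  shows "set (graph_word k l p ps) = set p"
proof -
  have "set (gadget k l p e) \<subseteq> set p" if "e \<in> set ps" for e
    using that assms by (auto simp: gadget_def Let_def split: if_splits)
  then show ?thesis
    by (auto simp: graph_word_def)
qed

theorem theorem8:
  fixes k l :: nat and a b :: 'b and V :: "'a set" and E :: "'a set set"
  assumes "k \<ge> 2" and "l \<ge> 2" and "a \<noteq> b"
    and "finite_simple_graph V E"
  shows "representable (replicate k a @ replicate l b) V E"
proof -
  have fin: "finite V"
    using assms(4) by (rule finite_simple_graph.finite_vertices)
  then obtain p where p: "set p = V" "distinct p"
    using finite_distinct_list by blast
  \<comment> \<open>Each non-edge enters as both ordered pairs, so \<open>graph_word_occurs\<close>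
    applies to x, y in either order.\<close>
  let ?N = "{(x, y). x \<in> V \<and> y \<in> V \<and> x \<noteq> y \<and> {x, y} \<notin> E}"
  have "finite ?N"
    using fin by (auto intro: finite_subset[of _ "V \<times> V"])
  then obtain ps where ps: "set ps = ?N"
    using finite_list by blast
  let ?w = "graph_word k l p ps"
  have avoid: "word_avoids (restrict_word ?w x y) (replicate k a @ replicate l b)"
    if "x \<in> V" "y \<in> V" "x \<noteq> y" "{x, y} \<in> E" for x y
  proof -
    have N: "\<forall>(c, d) \<in> set ps. c \<noteq> d \<and> {c, d} \<noteq> {x, y}"
      using that ps by auto
    from restrict_word_distinct[OF p(2)] that p(1)
    have "restrict_word p x y = [x, y] \<or> restrict_word p x y = [y, x]"
      by auto
    then have "double_free (restrict_word ?w x y)"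
    proof
      assume "restrict_word p x y = [x, y]"
      then show ?thesis
        by (rule double_free_graph_word[OF assms(1,2) that(3) _ N])
    next
      assume "restrict_word p x y = [y, x]"
      then have "restrict_word p y x = [y, x]"
        by (simp add: restrict_word_commute[of p y x])
      moreover have "\<forall>(c, d) \<in> set ps. c \<noteq> d \<and> {c, d} \<noteq> {y, x}"
        using N by (simp add: insert_commute)
      ultimately have "double_free (restrict_word ?w y x)"
        by (rule double_free_graph_word[OF assms(1,2) that(3)[symmetric]])
      then show ?thesis
        by (simp add: restrict_word_commute[of ?w x y])
    qed
    then show ?thesis
      by (rule double_free_avoids[OF _ assms(1-3)])
  qed
  have occur: "word_occurs (replicate k a @ replicate l b) (restrict_word ?w x y)"
    if "x \<in> V" "y \<in> V" "x \<noteq> y" "{x, y} \<notin> E" for x y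
    by (rule graph_word_occurs) (use that assms(1-3) ps in auto)
  have "set ?w = V"
    using set_graph_word[of ps p] ps p(1) by auto
  with avoid occur show ?thesis
    unfolding representable_def by (intro exI[of _ ?w]) blast
qed

end
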